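(* For every function $f:[0,1]\to\mathbb{R}$, $$\tfrac12\|f\|_{\mathrm{W}}\le V(f)\le\|f\|_{\mathrm{S}},$$ where $\|f\|_{\mathrm{W}}$, $V(f)$ and $\|f\|_{\mathrm{S}}$ denote the weak average smoothness, the variation, and the strong average smoothness of $f$, respectively (each taking values in $[0,\infty]$).
   Context: For $f:[0,1]\to\mathbb{R}$ and $x\in[0,1]$, the local slope of $f$ at $x$ is $$\Lambda_f(x)=\sup_{x'\in[0,1]\setminus\{x\}}\frac{|f(x)-f(x')|}{|x-x'|}\in[0,\infty].$$ Let $U$ be the uniform distribution (Lebesgue measure) on $[0,1]$ and let $X$ be a random variable distributed according to $U$. The strong average smoothness of $f$ is $\|f\|_{\mathrm{S}}=\mathbb{E}[\Lambda_f(X)]\in[0,\infty]$. The weak average smoothness of $f$ is $\|f\|_{\mathrm{W}}=\sup_{t>0}\,t\,U(\{x\in[0,1]:\Lambda_f(x)\ge t\})\in[0,\infty]$. The variation of $f$ on $[0,1]$ is $$V(f)=\sup_{0=x_0<x_1<\dots<x_n\le 1}\ \sum_{i=1}^n|f(x_i)-f(x_{i-1})|\in[0,\infty],$$ the supremum being over all $n$ and all such finite sequences. *)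

theory Defs
  imports "HOL-Analysis.Analysis"
begin

text \<open>
  A function on $[0,1]$ is represented by a function on all reals; every definition below inspects
  it only at points of \<open>{0..1}\<close>.
\<close>

definition unit_uniform :: "real measure" where
  "unit_uniform = lebesgue_on {0..1}"

definition local_slope :: "(real \<Rightarrow> real) \<Rightarrow> real \<Rightarrow> ennreal" where
  "local_slope f x = (SUP x' \<in> {0..1} - {x}. ennreal (\<bar>f x - f x'\<bar> / \<bar>x - x'\<bar>))"

text \<open>
  \<open>strong_smoothness f\<close> is the expectation of the $[0,\infty]$-valued random variable
  \<open>local_slope f X\<close> with \<open>X\<close> distributed according to \<open>unit_uniform\<close>. No measurability of \<open>f\<close> is
  needed for the integral, or for the measure of the superlevel sets in \<open>weak_smoothness\<close>, to be
  meaningful: \<open>local_slope f\<close> is always measurable on \<open>{0..1}\<close> (\<open>borel_measurable_local_slope\<close>).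
\<close>

definition strong_smoothness :: "(real \<Rightarrow> real) \<Rightarrow> ennreal" where
  "strong_smoothness f = (\<integral>\<^sup>+ x. local_slope f x \<partial>unit_uniform)"

definition weak_smoothness :: "(real \<Rightarrow> real) \<Rightarrow> ennreal" where
  "weak_smoothness f =
     (SUP t \<in> {0<..}. ennreal t * emeasure unit_uniform {x \<in> {0..1}. ennreal t \<le> local_slope f x})"

text \<open>
  A finite sequence $0 = x_0 < \dots < x_n \le 1$ is a pair of \<open>n\<close> and a function of which only the
  values on \<open>{0..n}\<close> matter. The case \<open>n = 0\<close> contributes \<open>0\<close>.
\<close>

definition unit_sequences :: "(nat \<times> (nat \<Rightarrow> real)) set" where
  "unit_sequences = {(n, x). x 0 = 0 \<and> strict_mono_on {0..n} x \<and> x n \<le> 1}"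

definition variation :: "(real \<Rightarrow> real) \<Rightarrow> ennreal" where
  "variation f = (SUP (n, x) \<in> unit_sequences. ennreal (\<Sum>i=1..n. \<bar>f (x i) - f (x (i - 1))\<bar>))"

lemma closed_local_slope_le:
  assumes "0 \<le> t"
  shows "closed {x \<in> {0..1}. local_slope f x \<le> ennreal t}"
proof -
  have eq: "local_slope f x \<le> ennreal t \<longleftrightarrow> (\<forall>x'\<in>{0..1}. \<bar>f x - f x'\<bar> \<le> t * \<bar>x - x'\<bar>)" for x
  proof -
    have "local_slope f x \<le> ennreal t \<longleftrightarrow> (\<forall>x'\<in>{0..1} - {x}. \<bar>f x - f x'\<bar> / \<bar>x - x'\<bar> \<le> t)"
      unfolding local_slope_def SUP_le_iff by (simp only: ennreal_le_iff[OF assms])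
    also have "\<dots> \<longleftrightarrow> (\<forall>x'\<in>{0..1} - {x}. \<bar>f x - f x'\<bar> \<le> t * \<bar>x - x'\<bar>)"
    proof (rule ball_cong[OF refl])
      fix x' assume "x' \<in> {0..1} - {x}"
      then have "0 < \<bar>x - x'\<bar>" by simp
      then show "\<bar>f x - f x'\<bar> / \<bar>x - x'\<bar> \<le> t \<longleftrightarrow> \<bar>f x - f x'\<bar> \<le> t * \<bar>x - x'\<bar>"
        by (rule pos_divide_le_eq)
    qed
    also have "\<dots> \<longleftrightarrow> (\<forall>x'\<in>{0..1}. \<bar>f x - f x'\<bar> \<le> t * \<bar>x - x'\<bar>)"
    proof -
      have "\<bar>f x - f x\<bar> \<le> t * \<bar>x - x\<bar>" by simp
      then show ?thesis by blast
    qed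
    finally show ?thesis .
  qed
  show ?thesis
    unfolding eq closed_sequential_limits
  proof (intro allI impI, elim conjE)
    fix X l
    assume X: "\<forall>n. X n \<in> {x \<in> {0..1}. \<forall>x'\<in>{0..1}. \<bar>f x - f x'\<bar> \<le> t * \<bar>x - x'\<bar>}"
      and lim: "X \<longlonglongrightarrow> l"
    have l: "l \<in> {0..1}"
      using closed_sequentially[of "{0..1::real}" X l] X lim by blast
    have "(\<lambda>n. t * \<bar>X n - l\<bar>) \<longlonglongrightarrow> t * \<bar>l - l\<bar>"
      by (intro tendsto_intros lim)
    then have bound: "(\<lambda>n. t * \<bar>X n - l\<bar>) \<longlonglongrightarrow> 0"
      by simp
    have "\<forall>n. norm (f (X n) - f l) \<le> t * \<bar>X n - l\<bar>"
      using X l by (simp only: mem_Collect_eq real_norm_def) blast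
    then have "\<forall>\<^sub>F n in sequentially. norm (f (X n) - f l) \<le> t * \<bar>X n - l\<bar>"
      by simp
    then have "(\<lambda>n. f (X n) - f l) \<longlonglongrightarrow> 0"
      by (rule Lim_null_comparison[OF _ bound])
    then have flim: "(\<lambda>n. f (X n)) \<longlonglongrightarrow> f l"
      by (simp add: LIM_zero_iff)
    have "\<bar>f l - f x'\<bar> \<le> t * \<bar>l - x'\<bar>" if "x' \<in> {0..1}" for x'
    proof (rule LIMSEQ_le)
      show "(\<lambda>n. \<bar>f (X n) - f x'\<bar>) \<longlonglongrightarrow> \<bar>f l - f x'\<bar>"
        by (intro tendsto_intros flim)
      show "(\<lambda>n. t * \<bar>X n - x'\<bar>) \<longlonglongrightarrow> t * \<bar>l - x'\<bar>"
        by (intro tendsto_intros lim)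
      show "\<exists>N. \<forall>n\<ge>N. \<bar>f (X n) - f x'\<bar> \<le> t * \<bar>X n - x'\<bar>"
        using X that by blast
    qed
    with l show "l \<in> {x \<in> {0..1}. \<forall>x'\<in>{0..1}. \<bar>f x - f x'\<bar> \<le> t * \<bar>x - x'\<bar>}"
      by blast
  qed
qed

lemma borel_measurable_local_slope:
  "local_slope f \<in> borel_measurable unit_uniform"
proof (rule borel_measurableI_le)
  fix y :: ennreal
  have "{x \<in> {0..1}. local_slope f x \<le> y} \<in> sets borel"
  proof (cases y)
    case (real r)
    then show ?thesis using borel_closed[OF closed_local_slope_le[of r f]] by simp
  qed simp
  then show "{x \<in> space unit_uniform. local_slope f x \<le> y} \<in> sets unit_uniform"
    by (auto simp: unit_uniform_def sets_restrict_space_iff)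
qed

end

theory Submission imports Defs begin

text \<open>
  The right inequality rests on the mediant inequality. If \<open>a < x < b\<close>, then the slope of \<open>f\<close>
  between \<open>a\<close> and \<open>b\<close> is a weighted mean of the slopes between \<open>a\<close>, \<open>x\<close> and between \<open>x\<close>, \<open>b\<close>, so
  \<open>local_slope f x\<close> is at least $|f(b)-f(a)|/(b-a)$. Integrating this over $(a,b)$ gives
  $|f(b)-f(a)|\le\int_a^b\Lambda_f$, and the intervals between consecutive points of a sequence are
  disjoint.

  The left inequality is a weak-type maximal inequality, and the factor $2$ counts the two sides of
  a point. The variation may be assumed finite. Let $v(y)$ be the variation of \<open>f\<close> on
  $[0,y]$: a nondecreasing function with values between $0$ and $V(f)$ and with
  $|f(y)-f(x)|\le v(y)-v(x)$ for $x<y$. If $0<s<t$ and $\Lambda_f(x)\ge t$, then some chord of the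
  graph of \<open>v\<close> from $x$, to the right or to the left, has slope greater than $s$
  (\<open>right_steep\<close>, \<open>left_steep\<close>). Each of these two sets of points $x$ has measure at most
  $V(f)/s$ in $[0,1]$; hence $s\,U(\Lambda_f\ge t)\le 2V(f)$, and one lets $s$ tend to $t$.

  The one-sided bound (\<open>emeasure_right_steep_le\<close>) is an instance of the rising sun phenomenon. By
  inner regularity it suffices to treat a closed set $K$ of right-steep points
  (\<open>measure_closed_right_steep_le\<close>). There one follows $y$ from left to right, keeping
  $s\,\lambda(K\cap(-\infty,y])$ below the growth of \<open>v\<close> so far. At a point of $K$ one jumps along a
  steep chord, off $K$ one moves freely, and at a limit of such moves monotonicity of \<open>v\<close> and
  continuity of the measure preserve the invariant. The left-sided bound follows by reflection.
\<close>

section \<open>A one-sided maximal inequality for monotone functions\<close>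

definition right_steep :: "(real \<Rightarrow> real) \<Rightarrow> real \<Rightarrow> real set" where
  "right_steep v s = {x. \<exists>y>x. s * (y - x) < v y - v x}"

definition left_steep :: "(real \<Rightarrow> real) \<Rightarrow> real \<Rightarrow> real set" where
  "left_steep v s = {x. \<exists>y<x. s * (x - y) < v x - v y}"

lemma left_steep_eq_vimage:
  "left_steep v s = uminus -` right_steep (\<lambda>x. - v (- x)) s"
proof -
  have "(\<exists>y<x. s * (x - y) < v x - v y) \<longleftrightarrow> (\<exists>y>(- x). s * (y + x) < v x - v (- y))" for x
  proof
    assume "\<exists>y<x. s * (x - y) < v x - v y"
    then obtain y where "y < x" "s * (x - y) < v x - v y" by blast
    then show "\<exists>y>(- x). s * (y + x) < v x - v (- y)"
      by (intro exI[of _ "- y"]) (auto simp: algebra_simps)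
  next
    assume "\<exists>y>(- x). s * (y + x) < v x - v (- y)"
    then obtain y where "y > - x" "s * (y + x) < v x - v (- y)" by blast
    then show "\<exists>y<x. s * (x - y) < v x - v y"
      by (intro exI[of _ "- y"]) (auto simp: algebra_simps)
  qed
  then show ?thesis by (simp add: left_steep_def right_steep_def vimage_def add.commute)
qed

text \<open>
  Without monotonicity a one-sided set of this kind can fail to be measurable. At a continuity point
  of \<open>v\<close> a steep chord stays steep when its left end is moved slightly, so right-steep continuity
  points are interior, and a monotone function has only countably many other points.
\<close>

lemma borel_right_steep:
  assumes "mono v"
  shows "right_steep v s \<in> sets borel"
proof -
  have "x \<in> interior (right_steep v s)" if x: "x \<in> right_steep v s" and "isCont v x" for x
  proof -
    obtain y where y: "x < y" "s * (y - x) < v y - v x"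
      using x by (auto simp: right_steep_def)
    have "(v \<longlongrightarrow> v x) (nhds x)"
      using \<open>isCont v x\<close> by (simp only: isCont_def tendsto_at_iff_tendsto_nhds)
    then have "((\<lambda>z. v y - v z - s * (y - z)) \<longlongrightarrow> v y - v x - s * (y - x)) (nhds x)"
      by (intro tendsto_diff tendsto_mult tendsto_const filterlim_ident)
    moreover have "0 < v y - v x - s * (y - x)" using y by simp
    ultimately have "\<forall>\<^sub>F z in nhds x. 0 < v y - v z - s * (y - z)"
      by (rule order_tendstoD(1))
    moreover have "\<forall>\<^sub>F z in nhds x. z < y"
      using y eventually_nhds_in_open[of "{..<y}" x] by simp
    ultimately have "\<forall>\<^sub>F z in nhds x. z \<in> right_steep v s"
      by eventually_elim (auto simp: right_steep_def)
    then show ?thesis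
      by (auto simp: eventually_nhds interior_def)
  qed
  then have eq: "right_steep v s = interior (right_steep v s) \<union> {x \<in> right_steep v s. \<not> isCont v x}"
    using interior_subset by blast
  have "countable {x \<in> right_steep v s. \<not> isCont v x}"
    by (rule countable_subset[OF _ mono_ctble_discont[OF assms]]) auto
  then have "{x \<in> right_steep v s. \<not> isCont v x} \<in> sets borel"
    by (rule sets.countable[rotated]) simp
  then have "interior (right_steep v s) \<union> {x \<in> right_steep v s. \<not> isCont v x} \<in> sets borel"
    by (rule sets.Un[OF borel_open[OF open_interior]])
  then show ?thesis by (simp only: eq[symmetric])
qed

lemma borel_left_steep:
  assumes "mono v"
  shows "left_steep v s \<in> sets borel"
proof -
  have "mono (\<lambda>x. - v (- x))" using assms by (auto simp: mono_def)
  then have "uminus -` right_steep (\<lambda>x. - v (- x)) s \<inter> space borel \<in> sets borel"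
    by (intro measurable_sets[of uminus borel borel] borel_right_steep) auto
  then show ?thesis by (simp add: left_steep_eq_vimage)
qed

lemma fmeasurable_Icc: "{a..b::real} \<in> fmeasurable lborel"
  using fmeasurable_cbox[of a b] by simp

text \<open>
  The invariant is \<open>y \<in> T\<close>. It holds at \<open>a\<close>, it passes to suprema, and from any \<open>z \<in> T\<close> it can be
  carried to a larger point; thus it reaches \<open>b\<close>. Closedness of \<open>K\<close> is what allows a move away
  from a point \<open>z \<notin> K\<close>, since then \<open>K\<close> has a gap to the right of \<open>z\<close>.
\<close>

lemma measure_closed_right_steep_le:
  fixes v :: "real \<Rightarrow> real"
  assumes v: "mono v" "\<And>x. c \<le> v x" "\<And>x. v x \<le> d"
    and s: "0 < s" and K: "closed K" "K \<subseteq> {a..b}" "K \<subseteq> right_steep v s"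
  shows "s * measure lborel K \<le> d - c"
proof (cases "a \<le> b")
  case False
  then have "K = {}" using K by auto
  then show ?thesis using v(2,3)[of 0] by simp
next
  case ab: True
  define m where "m y = measure lborel (K \<inter> {..y})" for y
  have fm: "K \<inter> {..y} \<in> fmeasurable lborel" for y
  proof (rule fmeasurableI2[of "{a..b}"])
    show "K \<inter> {..y} \<in> sets lborel" using K by (auto intro: borel_closed)
  qed (use K fmeasurable_Icc in auto)
  have bK: "K \<inter> {..y} \<in> sets borel" for y using K by (auto intro: borel_closed)
  have m_mono: "m y \<le> m z" if "y \<le> z" for y z
    unfolding m_def by (rule measure_mono_fmeasurable) (use that fm bK in auto)
  have m_step: "m z \<le> m y + (z - y)" if "y \<le> z" for y z
  proof -
    have "m z \<le> measure lborel (K \<inter> {..y} \<union> {y..z})"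
      unfolding m_def
      by (rule measure_mono_fmeasurable) (use fm bK fmeasurable_Icc in auto)
    also have "\<dots> \<le> m y + measure lborel {y..z}"
      unfolding m_def by (rule measure_Un_le) (use fm bK in auto)
    finally show ?thesis using that by simp
  qed
  have mb: "m b = measure lborel K"
    using K by (auto simp: m_def intro!: arg_cong[where f="measure lborel"])
  define T where "T = {y. s * m y \<le> v y - c}"
  define S where "S = T \<inter> {a..b}"
  define z where "z = Sup S"
  have "m a \<le> measure lborel {a}"
    unfolding m_def by (rule measure_mono_fmeasurable) (use K bK fmeasurable_Icc[of a a] in auto)
  then have "m a = 0" by (simp add: m_def measure_le_0_iff)
  then have aS: "a \<in> S" using ab v by (simp add: S_def T_def)
  have bdd: "bdd_above S" by (auto simp: S_def)
  have az: "a \<le> z" using cSup_upper[OF aS bdd] by (simp add: z_def)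
  have zT: "z \<in> T"
  proof -
    have "s * m z \<le> v z - c + e" if "0 < e" for e
    proof -
      have "z - e / s < Sup S" using that s by (simp add: z_def)
      then obtain y where y: "y \<in> S" "z - e / s < y"
        using less_cSup_iff[OF _ bdd] aS by blast
      have yz: "y \<le> z" using cSup_upper[OF y(1) bdd] by (simp add: z_def)
      have "s * m z \<le> s * (m y + (z - y))"
        using m_step[OF yz] s by simp
      also have "\<dots> \<le> (v y - c) + s * (z - y)"
        using y by (simp add: S_def T_def algebra_simps)
      also have "s * (z - y) \<le> e"
        using y s by (simp add: field_simps)
      also have "v y \<le> v z" using v(1) yz by (rule monoD)
      finally show ?thesis by simp
    qed
    then have "s * m z \<le> v z - c" by (rule field_le_epsilon)
    then show ?thesis by (simp add: T_def)
  qed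
  show ?thesis
  proof (cases "z = b")
    case True
    then show ?thesis using zT v(3)[of b] mb by (simp add: T_def)
  next
    case False
    \<comment> \<open>The chord from \<open>z\<close> may end beyond \<open>b\<close>; since \<open>K\<close> has no points there, this is harmless.\<close>
    obtain y where y: "z < y" "y \<in> T"
    proof (cases "z \<in> K")
      case True
      then obtain y where y: "z < y" "s * (y - z) < v y - v z"
        using K by (auto simp: right_steep_def)
      have "s * m y \<le> s * (m z + (y - z))" using m_step[of z y] y s by simp
      also have "\<dots> \<le> v y - c" using y zT by (simp add: T_def algebra_simps)
      finally show ?thesis using y that by (simp add: T_def)
    next
      case False
      then obtain e where e: "0 < e" "ball z e \<subseteq> - K"
        using K(1) open_contains_ball[of "- K"] by auto
      have "K \<inter> {..z + e / 2} = K \<inter> {..z}"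
      proof -
        have "x \<notin> K" if "z < x" "x \<le> z + e / 2" for x
          using e that by (auto simp: subset_iff dist_real_def)
        then show ?thesis using e by (force simp: not_le)
      qed
      then have "m (z + e / 2) = m z" by (simp add: m_def)
      moreover have "v z \<le> v (z + e / 2)" by (rule monoD[OF v(1)]) (use e in simp)
      ultimately show ?thesis using zT e that[of "z + e / 2"] by (simp add: T_def)
    qed
    have "b < y"
    proof (rule ccontr)
      assume "\<not> b < y"
      then have "y \<in> S" using y az by (simp add: S_def)
      then show False using cSup_upper[of y S] bdd y by (simp add: z_def)
    qed
    then have "s * m b \<le> s * m y" using m_mono s by simp
    also have "\<dots> \<le> d - c" using y v(3)[of y] by (simp add: T_def)
    finally show ?thesis by (simp add: mb)
  qed
qed

lemma emeasure_right_steep_le: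
  fixes v :: "real \<Rightarrow> real"
  assumes v: "mono v" "\<And>x. c \<le> v x" "\<And>x. v x \<le> d" and s: "0 < s"
  shows "emeasure lborel (right_steep v s \<inter> {a..b}) \<le> ennreal ((d - c) / s)"
proof -
  let ?A = "right_steep v s \<inter> {a..b}"
  have A: "?A \<in> sets borel" using borel_right_steep[OF v(1)] by auto
  have fA: "?A \<in> fmeasurable lborel"
    by (rule fmeasurableI2[of "{a..b}"]) (use A fmeasurable_Icc in auto)
  have "measure lborel ?A \<le> (d - c) / s + e" if "0 < e" for e
  proof -
    have "?A \<in> sets lebesgue" using A by simp
    then obtain K where K: "closed K" "K \<subseteq> ?A" "emeasure lebesgue (?A - K) < ennreal e"
      using \<open>0 < e\<close> by (rule sets_lebesgue_inner_closed)
    have Kb: "K \<in> sets borel" using K by (intro borel_closed)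
    have "emeasure lborel (?A - K) < ennreal e"
      using K(3) A Kb by simp
    then have "measure lborel (?A - K) \<le> e"
      unfolding measure_def using that by (intro enn2real_leI) auto
    have "K \<union> (?A - K) = ?A" using K(2) by blast
    moreover have "measure lborel (K \<union> (?A - K)) \<le> measure lborel K + measure lborel (?A - K)"
      by (rule measure_Un_le) (use A Kb in simp_all)
    ultimately have "measure lborel ?A \<le> measure lborel K + measure lborel (?A - K)" by simp
    also have "measure lborel K \<le> (d - c) / s"
      using measure_closed_right_steep_le[OF v s K(1), of a b] K(2) s by (simp add: field_simps)
    finally show ?thesis using \<open>measure lborel (?A - K) \<le> e\<close> by simp
  qed
  then have "measure lborel ?A \<le> (d - c) / s" by (rule field_le_epsilon)
  then show ?thesis
    unfolding emeasure_eq_measure2[OF fA] by (rule ennreal_leI)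
qed

lemma emeasure_left_steep_le:
  fixes v :: "real \<Rightarrow> real"
  assumes v: "mono v" "\<And>x. c \<le> v x" "\<And>x. v x \<le> d" and s: "0 < s"
  shows "emeasure lborel (left_steep v s \<inter> {a..b}) \<le> ennreal ((d - c) / s)"
proof -
  let ?w = "\<lambda>x. - v (- x)"
  have w: "mono ?w" using v(1) by (auto simp: mono_def)
  have "emeasure lborel (left_steep v s \<inter> {a..b})
      = emeasure lborel (uminus -` (right_steep ?w s \<inter> {-b..-a}) \<inter> space lborel)"
    by (rule arg_cong[where f="emeasure lborel"]) (auto simp: left_steep_eq_vimage)
  also have "\<dots> = emeasure (distr lborel borel uminus) (right_steep ?w s \<inter> {-b..-a})"
    by (rule emeasure_distr[symmetric]) (use borel_right_steep[OF w] in auto)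
  also have "\<dots> = emeasure lborel (right_steep ?w s \<inter> {-b..-a})"
    by (simp add: lborel_distr_uminus)
  also have "\<dots> \<le> ennreal ((- c - - d) / s)"
    by (rule emeasure_right_steep_le[OF w _ _ s]) (use v in auto)
  finally show ?thesis by simp
qed

section \<open>The weak average smoothness\<close>

text \<open>
  The sequences are required to end exactly at \<open>y\<close>, so that they can be continued by any later point.
\<close>

definition variation_upto :: "(real \<Rightarrow> real) \<Rightarrow> real \<Rightarrow> ennreal" where
  "variation_upto f y =
     (SUP (n, x) \<in> {(n, x) \<in> unit_sequences. x n = y}. ennreal (\<Sum>i=1..n. \<bar>f (x i) - f (x (i - 1))\<bar>))"

lemma variation_upto_le: "variation_upto f y \<le> variation f"
  unfolding variation_upto_def variation_def by (rule SUP_subset_mono) auto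

lemma unit_sequence_ending_at:
  assumes "0 \<le> y" "y \<le> 1"
  shows "{(n, x) \<in> unit_sequences. x n = y} \<noteq> {}"
proof (cases "y = 0")
  case True
  have "strict_mono_on {0..0::nat} (\<lambda>_. 0::real)"
    by (rule strict_mono_onI) simp
  then have "(0, \<lambda>_. 0) \<in> {(n, x) \<in> unit_sequences. x n = y}"
    using True by (simp add: unit_sequences_def)
  then show ?thesis by blast
next
  case False
  then have "strict_mono_on {0..1::nat} (\<lambda>i. if i = 0 then 0 else y)"
    using assms by (intro strict_mono_onI) auto
  then have "(1, \<lambda>i. if i = 0 then 0 else y) \<in> {(n, x) \<in> unit_sequences. x n = y}"
    using assms by (simp add: unit_sequences_def)
  then show ?thesis by blast
qed

lemma variation_upto_add_le:
  assumes "0 \<le> y" "y < z" "z \<le> 1"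
  shows "variation_upto f y + ennreal \<bar>f z - f y\<bar> \<le> variation_upto f z"
proof -
  have ne: "{(n, x) \<in> unit_sequences. x n = y} \<noteq> {}"
    using unit_sequence_ending_at[of y] assms by simp
  have "ennreal (\<Sum>i=1..n. \<bar>f (x i) - f (x (i - 1))\<bar>) + ennreal \<bar>f z - f y\<bar> \<le> variation_upto f z"
    if "(n, x) \<in> unit_sequences" "x n = y" for n x
  proof -
    define x' where "x' = x(Suc n := z)"
    have x: "x 0 = 0" "strict_mono_on {0..n} x" using that by (auto simp: unit_sequences_def)
    have "strict_mono_on {0..Suc n} x'"
    proof (rule strict_mono_onI)
      fix i j assume ij: "i \<in> {0..Suc n}" "j \<in> {0..Suc n}" "i < j"
      show "x' i < x' j"
      proof (cases "j = Suc n")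
        case True
        have "x i \<le> x n"
          using strict_mono_on_leD[OF x(2), of i n] ij by auto
        then show ?thesis using True ij that assms by (simp add: x'_def)
      next
        case False
        then show ?thesis using ij strict_mono_onD[OF x(2), of i j] by (simp add: x'_def)
      qed
    qed
    then have mem: "(Suc n, x') \<in> {(n, x) \<in> unit_sequences. x n = z}"
      using x assms by (simp add: unit_sequences_def x'_def)
    have "(\<Sum>i=1..n. \<bar>f (x' i) - f (x' (i - 1))\<bar>) = (\<Sum>i=1..n. \<bar>f (x i) - f (x (i - 1))\<bar>)"
      by (rule sum.cong) (auto simp: x'_def)
    then have "(\<Sum>i=1..Suc n. \<bar>f (x' i) - f (x' (i - 1))\<bar>)
        = (\<Sum>i=1..n. \<bar>f (x i) - f (x (i - 1))\<bar>) + \<bar>f z - f y\<bar>"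
      using that by (simp add: x'_def)
    then have "ennreal (\<Sum>i=1..n. \<bar>f (x i) - f (x (i - 1))\<bar>) + ennreal \<bar>f z - f y\<bar>
        = ennreal (\<Sum>i=1..Suc n. \<bar>f (x' i) - f (x' (i - 1))\<bar>)"
      by (simp add: ennreal_plus[symmetric] sum_nonneg del: ennreal_plus)
    also have "\<dots> \<le> variation_upto f z"
      unfolding variation_upto_def by (rule SUP_upper2[OF mem]) simp
    finally show ?thesis .
  qed
  then show ?thesis
    unfolding variation_upto_def[of f y] using ne
    by (subst ennreal_SUP_add_left[symmetric]) (auto intro!: SUP_least)
qed

lemma weak_smoothness_le_variation: "weak_smoothness f \<le> 2 * variation f"
proof (cases "variation f")
  case top
  then show ?thesis by (simp add: ennreal_mult_top)
next
  case (real D)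
  \<comment> \<open>Extending \<open>v\<close> by constants outside \<open>{0..1}\<close> makes it monotone and bounded on all reals.\<close>
  define v where "v y = enn2real (variation_upto f (max 0 (min 1 y)))" for y
  have fin: "variation_upto f y = ennreal (enn2real (variation_upto f y))" for y
    using variation_upto_le[of f y] real by (simp add: top.not_eq_extremum order_le_less_trans)
  have incr: "v y + \<bar>f z - f y\<bar> \<le> v z" if "0 \<le> y" "y < z" "z \<le> 1" for y z
  proof -
    have "ennreal (v y + \<bar>f z - f y\<bar>) \<le> ennreal (v z)"
      using variation_upto_add_le[OF that, of f] that fin[of y] fin[of z] by (simp add: v_def)
    then show ?thesis by (subst (asm) ennreal_le_iff) (simp_all add: v_def)
  qed
  have v: "mono v" "\<And>x. 0 \<le> v x" "\<And>x. v x \<le> D"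
  proof -
    show "mono v"
    proof (rule monoI)
      fix x y :: real assume "x \<le> y"
      let ?c = "\<lambda>x. max 0 (min 1 (x::real))"
      have "v (?c x) \<le> v (?c y)"
      proof (cases "?c x = ?c y")
        case False
        then have "?c x < ?c y" using \<open>x \<le> y\<close> by linarith
        then have "v (?c x) + \<bar>f (?c y) - f (?c x)\<bar> \<le> v (?c y)" by (intro incr) auto
        then show ?thesis using abs_ge_zero[of "f (?c y) - f (?c x)"] by linarith
      qed simp
      then show "v x \<le> v y" by (simp add: v_def)
    qed
    show "v x \<le> D" for x
      unfolding v_def using variation_upto_le[of f "max 0 (min 1 x)"] real
      by (metis enn2real_leI)
  qed (simp add: v_def)
  have "ennreal t * emeasure unit_uniform {x \<in> {0..1}. ennreal t \<le> local_slope f x} \<le> 2 * ennreal D"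
    if t: "0 < t" for t
  proof -
    define E where "E = {x \<in> {0..1}. ennreal t \<le> local_slope f x}"
    have "E \<in> sets unit_uniform"
      using measurable_sets[OF borel_measurable_local_slope, of "{ennreal t..}" f]
      by (auto simp: E_def unit_uniform_def vimage_def Int_def conj_commute)
    then have E: "E \<in> sets lebesgue"
      by (simp add: unit_uniform_def sets_restrict_space_iff)
    have em: "emeasure unit_uniform E = emeasure lebesgue E"
      unfolding unit_uniform_def by (rule emeasure_restrict_space) (auto simp: E_def)
    have fE: "E \<in> fmeasurable lebesgue"
      by (rule fmeasurableI2[of "{0..1}"]) (use E in \<open>auto simp: E_def\<close>)
    \<comment> \<open>The supremum defining the local slope need not be attained, hence the smaller slope \<open>s\<close>.\<close>
    have sub: "E \<subseteq> right_steep v s \<inter> {0..1} \<union> left_steep v s \<inter> {0..1}" if s: "0 < s" "s < t" for s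
    proof
      fix x assume x: "x \<in> E"
      have "ennreal s < ennreal t" using s by (simp add: ennreal_lessI)
      also have "\<dots> \<le> local_slope f x" using x by (simp add: E_def)
      finally have "ennreal s < local_slope f x" .
      then obtain y where "y \<in> {0..1} - {x}" "ennreal s < ennreal (\<bar>f x - f y\<bar> / \<bar>x - y\<bar>)"
        unfolding local_slope_def less_SUP_iff by blast
      then have y: "y \<in> {0..1}" "y \<noteq> x" "ennreal s < ennreal (\<bar>f x - f y\<bar> / \<bar>x - y\<bar>)"
        by auto
      then have "s < \<bar>f x - f y\<bar> / \<bar>x - y\<bar>" using s by (simp add: ennreal_less_iff)
      then have *: "s * \<bar>x - y\<bar> < \<bar>f x - f y\<bar>" using y by (simp add: pos_less_divide_eq)
      show "x \<in> right_steep v s \<inter> {0..1} \<union> left_steep v s \<inter> {0..1}"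
      proof (cases "x < y")
        case True
        then have "s * (y - x) < v y - v x" using * incr[of x y] x y by (simp add: E_def)
        then show ?thesis using x True by (auto simp: E_def right_steep_def)
      next
        case False
        then have "y < x" using y by simp
        then have "s * (x - y) < v x - v y" using * incr[of y x] x y by (simp add: E_def)
        then show ?thesis using x \<open>y < x\<close> by (auto simp: E_def left_steep_def)
      qed
    qed
    have bound: "s * measure lebesgue E \<le> 2 * D" if s: "0 < s" "s < t" for s
    proof -
      have b: "right_steep v s \<inter> {0..1} \<in> sets borel" "left_steep v s \<inter> {0..1} \<in> sets borel"
        using borel_right_steep[OF v(1)] borel_left_steep[OF v(1)] by auto
      have "emeasure lebesgue E \<le> emeasure lebesgue (right_steep v s \<inter> {0..1} \<union> left_steep v s \<inter> {0..1})"
        by (rule emeasure_mono[OF sub[OF s]]) (use b in \<open>auto intro!: sets_completionI_sets\<close>)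
      also have "\<dots> \<le> emeasure lborel (right_steep v s \<inter> {0..1}) + emeasure lborel (left_steep v s \<inter> {0..1})"
        using b by (simp add: emeasure_subadditive)
      also have "\<dots> \<le> ennreal ((D - 0) / s) + ennreal ((D - 0) / s)"
        by (intro add_mono emeasure_right_steep_le emeasure_left_steep_le v s)
      also have "\<dots> = ennreal (2 * D / s)"
        using s real by (simp add: ennreal_plus[symmetric] del: ennreal_plus)
      finally have "measure lebesgue E \<le> 2 * D / s"
        unfolding measure_def using s real by (intro enn2real_leI) auto
      then show ?thesis using s by (simp add: field_simps)
    qed
    have "t * measure lebesgue E \<le> 2 * D"
    proof (rule field_le_mult_one_interval)
      fix z :: real assume "0 < z" "z < 1"
      then show "z * (t * measure lebesgue E) \<le> 2 * D"
        using bound[of "z * t"] t by (simp add: mult.assoc)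
    qed
    then have "ennreal (t * measure lebesgue E) \<le> ennreal (2 * D)" by (rule ennreal_leI)
    then show ?thesis
      unfolding E_def[symmetric] em emeasure_eq_measure2[OF fE]
      using t real by (simp add: ennreal_mult)
  qed
  then show ?thesis
    unfolding weak_smoothness_def real by (intro SUP_least) auto
qed

section \<open>The strong average smoothness\<close>

text \<open>
  If both slopes from \<open>x\<close> to the ends of the interval were smaller than the slope of the chord, the
  triangle inequality through \<open>f x\<close> would make the increment over the interval too small.
\<close>

lemma slope_le_local_slope:
  assumes "0 \<le> a" "a < x" "x < b" "b \<le> 1"
  shows "ennreal (\<bar>f b - f a\<bar> / (b - a)) \<le> local_slope f x"
proof (rule ccontr)
  assume "\<not> ?thesis"
  then have lt: "local_slope f x < ennreal (\<bar>f b - f a\<bar> / (b - a))" by simp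
  have "\<bar>f x - f y\<bar> / \<bar>x - y\<bar> < \<bar>f b - f a\<bar> / (b - a)" if "y \<in> {a, b}" for y
  proof -
    have "ennreal (\<bar>f x - f y\<bar> / \<bar>x - y\<bar>) \<le> local_slope f x"
      unfolding local_slope_def by (rule SUP_upper) (use that assms in auto)
    also note lt
    finally show ?thesis by (simp add: ennreal_less_iff)
  qed
  from this[of a] this[of b]
  have "\<bar>f x - f a\<bar> < \<bar>f b - f a\<bar> / (b - a) * (x - a)" "\<bar>f x - f b\<bar> < \<bar>f b - f a\<bar> / (b - a) * (b - x)"
    using assms by (simp_all add: pos_divide_less_eq)
  then have "\<bar>f b - f a\<bar> < \<bar>f b - f a\<bar> / (b - a) * (x - a) + \<bar>f b - f a\<bar> / (b - a) * (b - x)"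
    by linarith
  also have "\<dots> = \<bar>f b - f a\<bar> / (b - a) * (b - a)" by (simp only: distrib_left[symmetric]) simp
  also have "\<dots> = \<bar>f b - f a\<bar>" using assms by simp
  finally show False by simp
qed

lemma increment_le_integral_local_slope:
  assumes "0 \<le> a" "a < b" "b \<le> 1"
  shows "ennreal \<bar>f b - f a\<bar> \<le> (\<integral>\<^sup>+ x. local_slope f x * indicator {a<..<b} x \<partial>unit_uniform)"
proof -
  let ?q = "\<bar>f b - f a\<bar> / (b - a)"
  have I: "{a<..<b} \<in> sets unit_uniform"
    using assms by (auto simp: unit_uniform_def sets_restrict_space_iff)
  have "emeasure unit_uniform {a<..<b} = emeasure lebesgue {a<..<b}"
    unfolding unit_uniform_def by (rule emeasure_restrict_space) (use assms in auto)
  then have "emeasure unit_uniform {a<..<b} = ennreal (b - a)" using assms by simp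
  moreover have "ennreal \<bar>f b - f a\<bar> = ennreal ?q * ennreal (b - a)"
    using assms by (subst ennreal_mult[symmetric]) auto
  ultimately have "ennreal \<bar>f b - f a\<bar> = (\<integral>\<^sup>+ x. ennreal ?q * indicator {a<..<b} x \<partial>unit_uniform)"
    using I by (simp add: nn_integral_cmult_indicator)
  also have "\<dots> \<le> (\<integral>\<^sup>+ x. local_slope f x * indicator {a<..<b} x \<partial>unit_uniform)"
    using slope_le_local_slope[of a _ b f] assms
    by (intro nn_integral_mono) (auto split: split_indicator)
  finally show ?thesis .
qed

lemma variation_le_strong_smoothness: "variation f \<le> strong_smoothness f"
proof -
  have "ennreal (\<Sum>i=1..n. \<bar>f (x i) - f (x (i - 1))\<bar>) \<le> strong_smoothness f"
    if "(n, x) \<in> unit_sequences" for n x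
  proof -
    have x: "x 0 = 0" "strict_mono_on {0..n} x" "x n \<le> 1"
      using that by (auto simp: unit_sequences_def)
    have le: "x i \<le> x j" if "i \<le> j" "j \<le> n" for i j
      using strict_mono_on_leD[OF x(2), of i j] that by auto
    let ?J = "\<lambda>i. {x (i - 1)<..<x i}"
    have bounds: "0 \<le> x (i - 1)" "x (i - 1) < x i" "x i \<le> 1" if "i \<in> {1..n}" for i
      using that le[of 0 "i - 1"] le[of i n] x strict_mono_onD[OF x(2), of "i - 1" i] by auto
    have J: "?J i \<in> sets unit_uniform" if "i \<in> {1..n}" for i
      using bounds[OF that] by (auto simp: unit_uniform_def sets_restrict_space_iff)
    have disj: "disjoint_family_on ?J {1..n}"
    proof -
      have "?J i \<inter> ?J j = {}" if "i \<in> {1..n}" "j \<in> {1..n}" "i < j" for i j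
        using le[of i "j - 1"] that by force
      then show ?thesis unfolding disjoint_family_on_def by (metis Int_commute linorder_neqE_nat)
    qed
    have "ennreal (\<Sum>i=1..n. \<bar>f (x i) - f (x (i - 1))\<bar>) = (\<Sum>i=1..n. ennreal \<bar>f (x i) - f (x (i - 1))\<bar>)"
      by (simp add: sum_ennreal)
    also have "\<dots> \<le> (\<Sum>i=1..n. \<integral>\<^sup>+ u. local_slope f u * indicator (?J i) u \<partial>unit_uniform)"
      by (intro sum_mono increment_le_integral_local_slope bounds)
    also have "\<dots> = (\<integral>\<^sup>+ u. (\<Sum>i=1..n. local_slope f u * indicator (?J i) u) \<partial>unit_uniform)"
      by (rule nn_integral_sum[symmetric])
        (use J borel_measurable_local_slope in \<open>auto intro!: borel_measurable_times_ennreal borel_measurable_indicator\<close>)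
    also have "\<dots> \<le> (\<integral>\<^sup>+ u. local_slope f u \<partial>unit_uniform)"
    proof (rule nn_integral_mono)
      fix u
      have "(\<Sum>i=1..n. indicator (?J i) u) = (indicator (\<Union>i\<in>{1..n}. ?J i) u :: ennreal)"
        by (rule indicator_UN_disjoint[symmetric]) (use disj in auto)
      also have "\<dots> \<le> 1" by (simp add: indicator_def)
      finally have "local_slope f u * (\<Sum>i=1..n. indicator (?J i) u) \<le> local_slope f u * 1"
        by (intro mult_left_mono) auto
      then show "(\<Sum>i=1..n. local_slope f u * indicator (?J i) u) \<le> local_slope f u"
        by (simp add: sum_distrib_left)
    qed
    finally show ?thesis by (simp add: strong_smoothness_def)
  qed
  then show ?thesis unfolding variation_def by (intro SUP_least) auto
qed

theorem theorem1p2: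
  fixes f :: "real \<Rightarrow> real"
  shows "(1 / 2) * weak_smoothness f \<le> variation f \<and> variation f \<le> strong_smoothness f"
proof
  have "(1 / 2) * weak_smoothness f \<le> (1 / 2) * (2 * variation f)"
    by (intro mult_left_mono weak_smoothness_le_variation) simp
  also have "\<dots> = variation f"
    by (simp add: mult.assoc[symmetric] ennreal_divide_times)
  finally show "(1 / 2) * weak_smoothness f \<le> variation f" .
qed (rule variation_le_strong_smoothness)

end
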